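(* For every integer $n$ with $0\le n\le 1450$, the sequence $\left(\binom{n}{k}\right)_{k\ge 0}$ (the $n$th row of Pascal's triangle) is infinitely log-concave.
   Context: For a sequence $(a_k)_{k\ge0}$ of real numbers, put $a_k=0$ for $k<0$ (and, if the sequence is a finite one $a_0,\ldots,a_n$, also $a_k=0$ for $k>n$). Define the operator $\mathcal{L}$ by $\mathcal{L}(a_k)=(b_k)_{k\ge 0}$ with $b_k=a_k^2-a_{k-1}a_{k+1}$. Let $\mathcal{L}^i$ denote its $i$-fold iterate. The sequence $(a_k)$ is infinitely log-concave if $\mathcal{L}^i(a_k)$ is a nonnegative sequence (all entries $\ge 0$) for all $i\ge1$. *)

theory Defs
  imports Complex_Main
begin

text \<open>
  A sequence $(a_k)_{k \ge 0}$ is a function on the naturals; the convention $a_{-1} = 0$ is the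
  case distinction below. A finite sequence $a_0, \ldots, a_n$ is represented by its extension
  with zeros beyond $n$.
\<close>

definition log_concave_op :: "(nat \<Rightarrow> real) \<Rightarrow> nat \<Rightarrow> real" where
  "log_concave_op a k = (a k)\<^sup>2 - (if k = 0 then 0 else a (k - 1)) * a (k + 1)"

definition infinitely_log_concave :: "(nat \<Rightarrow> real) \<Rightarrow> bool" where
  "infinitely_log_concave a \<longleftrightarrow> (\<forall>i\<ge>1. \<forall>k. (log_concave_op ^^ i) a k \<ge> 0)"

end

theory Submission
  imports Defs "HOL-Library.Nonpos_Ints" "HOL-Computational_Algebra.Fundamental_Theorem_Algebra"
begin

text \<open>
  By a theorem of Branden, if all zeros of \<open>\<Sum> a\<^sub>k x\<^sup>k\<close> are real and nonpositive, the same holds for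
  \<open>\<Sum> (a\<^sub>k\<^sup>2 - a\<^sub>k\<^sub>-\<^sub>1 a\<^sub>k\<^sub>+\<^sub>1) x\<^sup>k\<close>, and this can be iterated from \<open>(1 + x)\<^sup>n\<close>.

  If \<open>P(x) = \<Prod> (x + r\<^sub>i)\<close>, the new polynomial at \<open>y\<^sup>2\<close> is the constant term of
  \<open>P(y z) P(y / z) (1 - z\<^sup>2)\<close>, which is the image of \<open>f(x) = \<Prod> (r\<^sub>i\<^sup>2 + y\<^sup>2 + r\<^sub>i y x)\<close> under the linear
  functional sending \<open>x\<^sup>2\<^sup>k\<close> to the Catalan number \<open>C\<^sub>k\<close> and odd powers to \<open>0\<close>. For \<open>Re y > 0\<close> all
  zeros of \<open>f\<close> lie in the open left half plane, so the functional must not vanish on such polynomials.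
  It is \<open>f \<mapsto> (\<Sum> D\<^sup>2\<^sup>k f / (k! (k + 1)!)) (0)\<close>. The series \<open>\<Sum> x\<^sup>k / (k! (k + 1)!)\<close> is a limit of rescaled
  Laguerre polynomials, which are products of factors \<open>1 + s x\<close> with \<open>s \<ge> 0\<close>; and
  \<open>1 + s D\<^sup>2 = (1 + i \<surd>s D) (1 - i \<surd>s D)\<close> preserves the degree, the leading coefficient and the absence
  of zeros in a right half plane, since there \<open>Re (f' / f) > 0\<close>. A polynomial without zeros in
  \<open>Re x > t\<close>, where \<open>t < 0\<close>, is bounded below at \<open>0\<close> in terms of its degree and leading coefficient,
  so nothing is lost in the limit.
\<close>

subsection \<open>Zeros in half planes\<close>

lemma poly_pderiv_prod_linear:
  fixes A :: "complex multiset"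
  assumes "x \<notin># A"
  shows "poly (pderiv (\<Prod>r\<in>#A. [:-r, 1:])) x
           = poly (\<Prod>r\<in>#A. [:-r, 1:]) x * (\<Sum>r\<in>#A. 1 / (x - r))"
  using assms
proof (induction A)
  case (add r A)
  then have "x - r \<noteq> 0" by auto
  let ?g = "\<Prod>r\<in>#A. [:-r, 1:]"
  have "pderiv (\<Prod>r\<in>#add_mset r A. [:-r, 1:]) = [:-r, 1:] * pderiv ?g + ?g"
    by (simp add: pderiv_mult pderiv_pCons del: mult_pCons_left)
  then have "poly (pderiv (\<Prod>r\<in>#add_mset r A. [:-r, 1:])) x
      = poly ([:-r, 1:] * pderiv ?g + ?g) x" by (simp only:)
  also have "\<dots> = (x - r) * poly (pderiv ?g) x + poly ?g x" by (simp add: algebra_simps)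
  also have "poly (pderiv ?g) x = poly ?g x * (\<Sum>r\<in>#A. 1 / (x - r))" using add by simp
  finally have "poly (pderiv (\<Prod>r\<in>#add_mset r A. [:-r, 1:])) x
      = (x - r) * poly ?g x * (1 / (x - r) + (\<Sum>r\<in>#A. 1 / (x - r)))"
    using \<open>x - r \<noteq> 0\<close> by (simp add: distrib_left)
  then show ?case by (simp add: algebra_simps)
qed simp

lemma Re_sum_mset_pos:
  assumes "A \<noteq> {#}" "\<And>r. r \<in># A \<Longrightarrow> Re (f r) > 0"
  shows "Re (\<Sum>r\<in>#A. f r) > 0"
  using assms
proof (induction A)
  case (add r A)
  then show ?case by (cases "A = {#}") (auto simp: add_pos_pos)
qed simp

lemma Re_inverse_pos: "Re z > 0 \<Longrightarrow> Re (inverse z) > 0"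
  by (auto simp: Re_divide zero_less_divide_iff sum_power2_gt_zero_iff)

text \<open>A Gauss-Lucas argument. At such a zero \<open>f' / f\<close>, the sum \<open>S\<close>
  of all \<open>1 / (x - r)\<close>, equals \<open>-1 / c\<close>. Every \<open>u * (x - r)\<close>
  has positive real part, hence so do \<open>S / u\<close> and its inverse \<open>- (c * u)\<close>,
  against \<open>c\<close>. The factor \<open>u\<close> rotates the half plane: \<open>1\<close>
  gives right half planes, \<open>\<i>\<close> and \<open>-\<i>\<close> the lower and upper
  one.\<close>

lemma add_pderiv_nonzero_half_plane:
  fixes f :: "complex poly"
  assumes f: "\<And>x. Re (u * x) > t \<Longrightarrow> poly f x \<noteq> 0"
    and c: "Re (c * u) \<ge> 0" and x: "Re (u * x) > t"
  shows "poly (f + smult c (pderiv f)) x \<noteq> 0"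
proof
  assume zero: "poly (f + smult c (pderiv f)) x = 0"
  have "f \<noteq> 0" using f[OF x] by auto
  then obtain A where A: "f = smult (lead_coeff f) (\<Prod>r\<in>#A. [:-r, 1:])"
    using alg_closed_imp_factorization by blast
  have root: "poly f r = 0" if "r \<in># A" for r
    using that by (subst A) (auto simp: poly_prod_mset)
  have xA: "x \<notin># A" using root f x by blast
  define S where "S = (\<Sum>r\<in>#A. 1 / (x - r))"
  have "poly (pderiv f) x = poly f x * S"
    unfolding S_def by (subst (1 2) A) (simp add: pderiv_smult poly_pderiv_prod_linear[OF xA])
  with zero have "poly f x * (1 + c * S) = 0" by (simp add: algebra_simps)
  with f[OF x] have cS: "c * S = -1" by (simp add: add_eq_0_iff)
  then have "A \<noteq> {#}" by (auto simp: S_def)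
  have pos: "Re (u * (x - r)) > 0" if "r \<in># A" for r
  proof -
    have "Re (u * r) \<le> t" using root[OF that] f[of r] by force
    with x show ?thesis by (simp add: algebra_simps)
  qed
  from \<open>A \<noteq> {#}\<close> obtain r where "r \<in># A" by blast
  then have u: "u \<noteq> 0" using pos by force
  have "inverse u * S = (\<Sum>r\<in>#A. inverse (u * (x - r)))"
    unfolding S_def by (simp add: sum_mset_distrib_left divide_inverse)
  also have "Re \<dots> > 0"
    using \<open>A \<noteq> {#}\<close> pos by (intro Re_sum_mset_pos Re_inverse_pos)
  finally have "Re (inverse (inverse u * S)) > 0" by (rule Re_inverse_pos)
  moreover have "S \<noteq> 0" using cS by auto
  then have "inverse (inverse u * S) = - (c * u)"
    using cS u by (intro inverse_unique) (simp add: field_simps)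
  ultimately have "Re (- (c * u)) > 0" by (simp only:)
  with c show False by simp
qed

section \<open>Real polynomials whose complex zeros are all real and nonpositive\<close>

lemma map_poly_of_real_pCons:
  "map_poly complex_of_real (pCons a p) = pCons (of_real a) (map_poly of_real p)"
  by (simp add: map_poly_pCons)

lemma map_poly_of_real_mult:
  "map_poly complex_of_real (p * q) = map_poly of_real p * map_poly of_real q"
  by (rule poly_eqI) (simp add: coeff_map_poly coeff_mult)

lemma poly_map_poly_of_real:
  "poly (map_poly complex_of_real p) (of_real x) = of_real (poly p x)"
  by (induction p) (auto simp: map_poly_of_real_pCons)

text \<open>A complex zero exists and is real by hypothesis, so its linear factor splits off over
  the reals and the degree drops.\<close>

lemma nonpos_roots_imp_factorization:
  fixes p :: "real poly"
  assumes "p \<noteq> 0" "\<And>z. z \<notin> \<real>\<^sub>\<le>\<^sub>0 \<Longrightarrow> poly (map_poly complex_of_real p) z \<noteq> 0"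
  shows "\<exists>A. (\<forall>r\<in>#A. r \<ge> 0) \<and> p = smult (lead_coeff p) (\<Prod>r\<in>#A. [:r, 1:])"
  using assms
proof (induction "degree p" arbitrary: p rule: less_induct)
  case (less p)
  show ?case
  proof (cases "degree p = 0")
    case True
    then show ?thesis by (intro exI[of _ "{#}"]) (auto elim!: degree_eq_zeroE)
  next
    case False
    then have "degree (map_poly complex_of_real p) > 0"
      by (subst degree_map_poly) auto
    then obtain z where z: "poly (map_poly complex_of_real p) z = 0"
      using alg_closed_imp_poly_has_root by blast
    then obtain x where x: "z = of_real x" "x \<le> 0"
      using less.prems(2)[of z] by (auto elim!: nonpos_Reals_cases)
    have "poly p x = 0" using z unfolding x(1) poly_map_poly_of_real by simp
    then obtain q where q: "p = [:-x, 1:] * q"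
      using poly_eq_0_iff_dvd dvd_def by blast
    have q0: "q \<noteq> 0" using q less.prems(1) by auto
    have "degree p = Suc (degree q)" using q0 unfolding q by (subst degree_mult_eq) auto
    moreover have "poly (map_poly complex_of_real q) w \<noteq> 0" if "w \<notin> \<real>\<^sub>\<le>\<^sub>0" for w
      using less.prems(2)[OF that] unfolding q map_poly_of_real_mult by auto
    ultimately obtain A where A: "\<forall>r\<in>#A. r \<ge> 0"
        "q = smult (lead_coeff q) (\<Prod>r\<in>#A. [:r, 1:])"
      using less.hyps[of q] q0 by auto
    have lc: "lead_coeff p = lead_coeff q" unfolding q lead_coeff_mult by simp
    have "p = smult (lead_coeff p) (\<Prod>r\<in>#add_mset (-x) A. [:r, 1:])"
      unfolding lc by (subst q, subst A(2)) simp
    then show ?thesis using A(1) x(2) by (intro exI[of _ "add_mset (-x) A"]) auto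
  qed
qed

subsection \<open>Laguerre polynomials\<close>

lemma degree_add_pderiv_iterate:
  "degree (((\<lambda>f :: 'a :: field_char_0 poly. f + pderiv f) ^^ M) f) = degree f"
proof (induction M)
  case (Suc M)
  let ?g = "((\<lambda>f :: 'a poly. f + pderiv f) ^^ M) f"
  show ?case
  proof (cases "degree ?g = 0")
    case True
    then have "pderiv ?g = 0" by (simp add: pderiv_eq_0_iff)
    with Suc show ?thesis by simp
  next
    case False
    then show ?thesis using Suc by (simp add: degree_add_eq_left degree_pderiv)
  qed
qed simp

text \<open>Binomial expansion of \<open>(1 + D)^M\<close> applied to \<open>x^N\<close>; the term
  \<open>D^(N - k)\<close> contributes to \<open>x^k\<close>. The induction step is Pascal's
  rule.\<close>

lemma coeff_add_pderiv_iterate_monom: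
  assumes "k \<le> N"
  shows "coeff (((\<lambda>f :: 'a :: field_char_0 poly. f + pderiv f) ^^ M) (monom 1 N)) k
           = of_nat (M choose (N - k)) * fact N / fact k"
  using assms
proof (induction M arbitrary: k)
  case 0
  then show ?case by (cases "k = N") (auto simp: binomial_eq_0)
next
  case (Suc M)
  let ?g = "((\<lambda>f :: 'a poly. f + pderiv f) ^^ M) (monom 1 N)"
  show ?case
  proof (cases "k = N")
    case True
    have "degree ?g = N" by (simp add: degree_add_pderiv_iterate degree_monom_eq)
    then have "coeff ?g (Suc N) = 0" by (intro coeff_eq_0) simp
    then show ?thesis using Suc.IH[of N] True by (simp add: coeff_pderiv)
  next
    case False
    with Suc.prems have "N - k = Suc (N - Suc k)" by simp
    moreover have "(of_nat (Suc k) :: 'a) \<noteq> 0" by (simp del: of_nat_Suc)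
    ultimately show ?thesis using Suc.IH[of k] Suc.IH[of "Suc k"] Suc.prems False
      by (simp add: coeff_pderiv field_simps del: of_nat_Suc)
  qed
qed

text \<open>
  The generalised Laguerre polynomial of parameter \<open>1\<close> and degree \<open>N\<close>, evaluated at \<open>- x / N\<close>. Up to
  normalisation, before rescaling, it is \<open>(1 + D)\<^sup>N\<^sup>+\<^sup>1 x\<^sup>N\<close>, and \<open>1 + D\<close> preserves real-rootedness.
\<close>

lemma laguerre_real_rooted:
  fixes N :: nat
  shows "\<exists>A. (\<forall>s\<in>#A. s \<ge> (0::real)) \<and>
    (\<forall>k. coeff (\<Prod>s\<in>#A. [:1, s:]) k = real (N choose k) / (real N ^ k * fact (Suc k)))"
proof -
  let ?T = "\<lambda>f :: real poly. f + pderiv f"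
  let ?Tc = "\<lambda>f :: complex poly. f + pderiv f"
  define p where "p = (?T ^^ Suc N) (monom 1 N)"
  have deg: "degree p = N"
    unfolding p_def by (simp add: degree_add_pderiv_iterate degree_monom_eq del: funpow.simps)
  have coeff_p: "coeff p k = real (Suc N choose (N - k)) * fact N / fact k" if "k \<le> N" for k
    unfolding p_def by (rule coeff_add_pderiv_iterate_monom[OF that])
  \<comment> \<open>All coefficients are nonnegative and the constant one is positive. Excluding the
    zero \<open>0\<close> as well permits the division by \<open>r\<close> in the rescaling
    below.\<close>
  have p_pos: "poly p x > 0" if "x \<ge> 0" for x
  proof -
    have "poly p x = (\<Sum>k\<le>N. coeff p k * x ^ k)" by (simp add: poly_altdef deg)
    also have "\<dots> \<ge> (\<Sum>k\<in>{0}. coeff p k * x ^ k)"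
      using that by (intro sum_mono2) (auto simp: coeff_p)
    moreover have "(\<Sum>k\<in>{0}. coeff p k * x ^ k) > 0" by (simp add: coeff_p)
    ultimately show ?thesis by linarith
  qed
  have "p \<noteq> 0" using p_pos[of 0] by auto
  have complex_p: "map_poly complex_of_real p = (?Tc ^^ Suc N) (monom 1 N)"
  proof (rule poly_eqI)
    fix k show "coeff (map_poly complex_of_real p) k = coeff ((?Tc ^^ Suc N) (monom 1 N)) k"
    proof (cases "k \<le> N")
      case True
      then show ?thesis
        by (subst coeff_add_pderiv_iterate_monom) (simp_all add: coeff_map_poly coeff_p)
    next
      case False
      then show ?thesis
        by (subst (1 2) coeff_eq_0)
          (auto simp: deg degree_map_poly degree_add_pderiv_iterate degree_monom_eq
            simp del: funpow.simps)
    qed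
  qed
  \<comment> \<open>With \<open>c = 1\<close> and \<open>u\<close> imaginary, the borderline case
    \<open>Re (c * u) = 0\<close> applies to the upper and the lower half plane, so all zeros are
    real.\<close>
  have stable: "poly ((?Tc ^^ M) (monom 1 N)) z \<noteq> 0"
    if "Re (u * z) > 0" "Re u = 0" for u z :: complex and M
    using that(1)
  proof (induction M arbitrary: z)
    case (Suc M)
    have "poly ((?Tc ^^ M) (monom 1 N) + smult 1 (pderiv ((?Tc ^^ M) (monom 1 N)))) z \<noteq> 0"
      using Suc that(2) by (intro add_pderiv_nonzero_half_plane[where u = u and t = 0]) auto
    then show ?case by simp
  qed (auto simp: poly_monom)
  have "poly (map_poly complex_of_real p) z \<noteq> 0" if "z \<notin> \<real>\<^sub>\<le>\<^sub>0" for z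
  proof (cases "Im z = 0")
    case True
    then have z: "z = of_real (Re z)" by (simp add: complex_eq_iff)
    with that have "Re z > 0" by (metis nonpos_Reals_of_real_iff not_le)
    then show ?thesis using p_pos[of "Re z"] by (subst z) (simp add: poly_map_poly_of_real)
  next
    case False
    then show ?thesis unfolding complex_p
      using stable[of "\<i>" z "Suc N"] stable[of "-\<i>" z "Suc N"]
      by (cases "Im z > 0") (simp_all del: funpow.simps)
  qed
  from nonpos_roots_imp_factorization[OF \<open>p \<noteq> 0\<close> this] obtain A where
    A: "\<forall>r\<in>#A. r \<ge> 0" "p = smult (lead_coeff p) (\<Prod>r\<in>#A. [:r, 1:])" by blast
  have Apos: "r > 0" if "r \<in># A" for r
  proof -
    have "poly p (-r) = 0" using that by (subst A(2)) (auto simp: poly_prod_mset)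
    with p_pos[of "-r"] have "\<not> r \<le> 0" by auto
    then show ?thesis by simp
  qed
  have scale: "(\<Prod>r\<in>#B. [:r, 1:]) \<circ>\<^sub>p [:0, c:] = smult (\<Prod>r\<in>#B. r) (\<Prod>r\<in>#B. [:1, c / r:])"
    if "\<And>r. r \<in># B \<Longrightarrow> r > 0" for B and c :: real
    using that
  proof (induction B)
    case empty
    show ?case by (simp add: one_pCons)
  next
    case (add r B)
    have "(\<Prod>r\<in>#add_mset r B. [:r, 1:]) \<circ>\<^sub>p [:0, c:]
        = [:r, c:] * ((\<Prod>r\<in>#B. [:r, 1:]) \<circ>\<^sub>p [:0, c:])"
      by (simp add: pcompose_mult pcompose_pCons del: mult_pCons_left)
    also have "[:r, c:] = smult r [:1, c / r:]" using add.prems[of r] by simp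
    finally show ?case using add by (simp add: mult_ac del: mult_pCons_left smult_pCons)
  qed
  \<comment> \<open>The rescaling replaces \<open>r + x / N\<close> by
    \<open>r * (1 + x / (N * r))\<close>; \<open>b\<close> collects the constants and is found by
    comparing constant terms.\<close>
  define b where "b = lead_coeff p * (\<Prod>r\<in>#A. r)"
  define C where "C = image_mset (\<lambda>r. (1 / real N) / r) A"
  have pC: "p \<circ>\<^sub>p [:0, 1 / real N:] = smult b (\<Prod>s\<in>#C. [:1, s:])"
    by (subst A(2))
      (simp add: pcompose_smult scale[OF Apos] b_def C_def image_mset.compositionality o_def)
  have C_coeff: "b * coeff (\<Prod>s\<in>#C. [:1, s:]) k = coeff p k * (1 / real N) ^ k" for k
    using arg_cong[OF pC, of "\<lambda>q. coeff q k"] by (simp add: coeff_pcompose_linear mult.commute)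
  have "coeff (\<Prod>s\<in>#C. [:1, s:]) 0 = poly (\<Prod>s\<in>#C. [:1, s:]) 0"
    by (simp only: poly_0_coeff_0)
  also have "\<dots> = 1" by (simp add: poly_prod_mset)
  finally have b: "b = fact (Suc N)" using C_coeff[of 0] by (simp add: coeff_p algebra_simps)
  have "coeff (\<Prod>s\<in>#C. [:1, s:]) k = real (N choose k) / (real N ^ k * fact (Suc k))" for k
  proof (cases "k \<le> N")
    case True
    then have "real (Suc N choose (N - k)) = fact (Suc N) / (fact (N - k) * fact (Suc k))"
      by (subst binomial_fact) (simp_all add: Suc_diff_le del: fact_Suc)
    moreover have "real (N choose k) = fact N / (fact k * fact (N - k))"
      using True by (rule binomial_fact)
    ultimately have "fact (Suc N) * coeff (\<Prod>s\<in>#C. [:1, s:]) k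
        = fact (Suc N) * (real (N choose k) / (real N ^ k * fact (Suc k)))"
      using C_coeff[of k] True unfolding b
      by (simp add: coeff_p power_divide mult_ac del: fact_Suc)
    then show ?thesis by (simp only: mult_cancel_left fact_nonzero simp_thms)
  next
    case False
    then show ?thesis using C_coeff[of k] deg b by (simp add: coeff_eq_0 binomial_eq_0)
  qed
  moreover have "s \<ge> 0" if "s \<in># C" for s using that A(1) by (auto simp: C_def)
  ultimately show ?thesis by (intro exI[of _ C]) auto
qed

subsection \<open>Even differential operators\<close>

text \<open>The formal power series with coefficients \<open>a k\<close> in \<open>D^2\<close>,
  applied to \<open>f\<close>. Derivatives of order above \<open>degree f\<close> vanish, so the
  truncation loses nothing.\<close>

definition even_diff_op :: "(nat \<Rightarrow> real) \<Rightarrow> complex poly \<Rightarrow> complex poly" where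
  "even_diff_op a f = (\<Sum>k\<le>degree f. smult (of_real (a k)) ((pderiv ^^ (2 * k)) f))"

lemma degree_add_smult_higher_pderiv:
  fixes f :: "complex poly"
  shows "degree (f + smult c ((pderiv ^^ Suc m) f)) = degree f"
    and "lead_coeff (f + smult c ((pderiv ^^ Suc m) f)) = lead_coeff f"
proof -
  have "coeff ((pderiv ^^ Suc m) f) (degree f) = 0"
    by (simp only: coeff_higher_pderiv) (simp add: coeff_eq_0)
  then have lc: "coeff (f + smult c ((pderiv ^^ Suc m) f)) (degree f) = lead_coeff f"
    by (simp del: funpow.simps)
  have "degree (f + smult c ((pderiv ^^ Suc m) f)) \<le> degree f"
    by (rule degree_add_le)
      (auto simp del: funpow.simps intro: order.trans[OF degree_smult_le] simp: degree_higher_pderiv)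
  moreover have "degree f \<le> degree (f + smult c ((pderiv ^^ Suc m) f))"
  proof (cases "f = 0")
    case False
    then show ?thesis using lc by (intro le_degree) auto
  qed simp
  ultimately show deg: "degree (f + smult c ((pderiv ^^ Suc m) f)) = degree f" by (rule antisym)
  show "lead_coeff (f + smult c ((pderiv ^^ Suc m) f)) = lead_coeff f" unfolding deg lc ..
qed

text \<open>Multiplying symbols composes operators, so a product of factors \<open>1 + s x\<close>
  can be treated one factor at a time.\<close>

lemma even_diff_op_mult_linear:
  "even_diff_op (coeff ([:1, s:] * p)) f
     = even_diff_op (coeff p) (f + smult (of_real s) (pderiv (pderiv f)))"
proof -
  define n where "n = degree f"
  define g where "g = f + smult (of_real s) (pderiv (pderiv f))"
  let ?D = "\<lambda>k. (pderiv ^^ (2 * k)) f"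
  have deg: "degree g = n" unfolding g_def n_def
    using degree_add_smult_higher_pderiv(1)[of f "of_real s" 1] by simp
  have Dg: "(pderiv ^^ (2 * k)) g = ?D k + smult (of_real s) (?D (Suc k))" for k
    by (simp add: g_def higher_pderiv_add higher_pderiv_smult funpow_swap1)
  have D0: "?D (Suc n) = 0"
    by (rule poly_eqI) (simp only: coeff_higher_pderiv, simp add: n_def coeff_eq_0)
  have "even_diff_op (coeff ([:1, s:] * p)) f
      = (\<Sum>k\<le>Suc n. smult (of_real (coeff ([:1, s:] * p) k)) (?D k))"
    unfolding even_diff_op_def n_def[symmetric] sum.atMost_Suc D0 by simp
  also have "\<dots> = (\<Sum>k\<le>Suc n. smult (of_real (coeff p k)) (?D k))
      + (\<Sum>k\<le>Suc n. smult (of_real (if k = 0 then 0 else s * coeff p (k - 1))) (?D k))"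
    unfolding sum.distrib[symmetric]
    by (intro sum.cong refl) (simp add: coeff_pCons smult_add_left split: nat.splits)
  also have "(\<Sum>k\<le>Suc n. smult (of_real (coeff p k)) (?D k))
      = (\<Sum>k\<le>n. smult (of_real (coeff p k)) (?D k))"
    unfolding sum.atMost_Suc D0 by simp
  also have "(\<Sum>k\<le>Suc n. smult (of_real (if k = 0 then 0 else s * coeff p (k - 1))) (?D k))
      = (\<Sum>k\<le>n. smult (of_real (s * coeff p k)) (?D (Suc k)))"
    by (subst sum.atMost_Suc_shift) (simp del: funpow.simps mult_Suc_right)
  also have "(\<Sum>k\<le>n. smult (of_real (coeff p k)) (?D k)) + \<dots>
      = even_diff_op (coeff p) g"
    unfolding even_diff_op_def deg Dg sum.distrib[symmetric]
    by (simp add: smult_add_right mult_ac)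
  finally show ?thesis unfolding g_def .
qed

lemma even_diff_op_stable:
  assumes "\<And>s. s \<in># A \<Longrightarrow> s \<ge> 0" and "\<And>x. Re x > t \<Longrightarrow> poly f x \<noteq> 0"
  defines "g \<equiv> even_diff_op (coeff (\<Prod>s\<in>#A. [:1, s:])) f"
  shows "degree g = degree f \<and> lead_coeff g = lead_coeff f
    \<and> (\<forall>x. Re x > t \<longrightarrow> poly g x \<noteq> 0)"
  using assms(1,2) unfolding g_def
proof (induction A arbitrary: f)
  case empty
  have "even_diff_op (coeff 1) f = (\<Sum>k\<in>{0}. smult (of_real (coeff 1 k)) ((pderiv ^^ (2 * k)) f))"
    unfolding even_diff_op_def by (rule sum.mono_neutral_right) auto
  then have "even_diff_op (coeff 1) f = f" by (simp only: coeff_1) simp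
  then show ?case using empty unfolding image_mset_empty prod_mset_empty by metis
next
  case (add s A)
  define h where "h = f + smult (of_real s) (pderiv (pderiv f))"
  \<comment> \<open>Since \<open>c\<close> is imaginary, \<open>c\<close> and \<open>-c\<close> both
    satisfy the condition of the half plane lemma with \<open>u = 1\<close>.\<close>
  define c where "c = \<i> * of_real (sqrt s)"
  have c2: "c * c = - of_real s"
    using add.prems(1)[of s] by (simp add: c_def complex_eq_iff)
  define f1 where "f1 = f + smult c (pderiv f)"
  have f1: "poly f1 x \<noteq> 0" if "Re x > t" for x
    unfolding f1_def using that add.prems(2)
    by (intro add_pderiv_nonzero_half_plane[where u = 1 and t = t]) (auto simp: c_def)
  have f2: "poly (f1 + smult (-c) (pderiv f1)) x \<noteq> 0" if "Re x > t" for x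
    using that f1
    by (intro add_pderiv_nonzero_half_plane[where u = 1 and t = t]) (auto simp: c_def)
  have h: "h = f1 + smult (-c) (pderiv f1)"
    by (simp add: h_def f1_def pderiv_add pderiv_smult smult_add_right c2)
  have lc: "degree h = degree f" "lead_coeff h = lead_coeff f"
    using degree_add_smult_higher_pderiv[of f "of_real s" 1] by (simp_all add: h_def)
  have "even_diff_op (coeff (\<Prod>s\<in>#add_mset s A. [:1, s:])) f
      = even_diff_op (coeff (\<Prod>s\<in>#A. [:1, s:])) h"
    unfolding h_def image_mset_add_mset prod_mset.add_mset by (rule even_diff_op_mult_linear)
  moreover have "poly h x \<noteq> 0" if "Re x > t" for x
    using f2[OF that] by (simp only: h not_False_eq_True)
  ultimately show ?case using add.IH[of h] add.prems(1) lc
    by (metis union_single_eq_member insert_iff set_mset_add_mset_insert)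
qed

text \<open>Every zero has real part at most \<open>t\<close>, hence modulus at least
  \<open>-t\<close>, and the value at \<open>0\<close> is, up to sign, the leading coefficient times
  the product of the zeros.\<close>

lemma norm_poly_0_ge:
  fixes f :: "complex poly"
  assumes "t < 0" and f: "\<And>x. Re x > t \<Longrightarrow> poly f x \<noteq> 0"
  shows "norm (poly f 0) \<ge> norm (lead_coeff f) * (-t) ^ degree f"
proof -
  have "f \<noteq> 0" using f[of 0] assms(1) by auto
  then obtain A where A: "size A = degree f" "f = smult (lead_coeff f) (\<Prod>r\<in>#A. [:-r, 1:])"
    using alg_closed_imp_factorization by blast
  have root: "norm r \<ge> -t" if "r \<in># A" for r
  proof -
    have "poly f r = 0" using that by (subst A(2)) (auto simp: poly_prod_mset)
    then have "Re r \<le> t" using f[of r] by force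
    then show ?thesis using complex_Re_le_cmod[of "-r"] by simp
  qed
  have "norm (\<Prod>r\<in>#B. - r) \<ge> (-t) ^ size B"
    if "\<And>r. r \<in># B \<Longrightarrow> norm r \<ge> -t" for B :: "complex multiset"
    using that
  proof (induction B)
    case (add r B)
    then have "(-t) * (-t) ^ size B \<le> norm r * norm (\<Prod>r\<in>#B. - r)"
      using assms(1) by (intro mult_mono) auto
    then show ?case by (simp add: norm_mult)
  qed simp
  from this[of A, OF root] have "norm (\<Prod>r\<in>#A. - r) \<ge> (-t) ^ degree f" by (simp add: A(1))
  moreover have "poly f 0 = lead_coeff f * (\<Prod>r\<in>#A. - r)"
    by (subst A(2)) (simp add: poly_prod_mset image_mset.compositionality o_def)
  ultimately show ?thesis by (simp add: norm_mult mult_left_mono)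
qed

text \<open>\<open>k! * (N choose k) / N^k\<close> is the product of \<open>1 - i / N\<close> over
  \<open>i < k\<close>, and each factor tends to \<open>1\<close>.\<close>

lemma laguerre_coeff_tendsto:
  "(\<lambda>N. real (N choose k) / (real N ^ k * fact (Suc k))) \<longlonglongrightarrow> 1 / (fact k * fact (Suc k))"
proof -
  have "(\<lambda>N. \<Prod>i<k. (1 - real i * inverse (real N))) \<longlonglongrightarrow> (\<Prod>i<k. (1 - real i * 0))"
    by (intro tendsto_intros lim_inverse_n)
  moreover have "eventually (\<lambda>N. (\<Prod>i<k. (1 - real i * inverse (real N)))
      = fact k * real (N choose k) / real N ^ k) sequentially"
    using eventually_ge_at_top[of "Suc k"]
  proof eventually_elim
    case (elim N)
    then have "(\<Prod>i<k. (1 - real i * inverse (real N))) = (\<Prod>i<k. (real N - real i) / real N)"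
      by (intro prod.cong) (auto simp: field_simps)
    then show ?case
      by (simp add: binomial_gbinomial gbinomial_prod_rev prod_dividef atLeast0LessThan)
  qed
  ultimately have "(\<lambda>N. fact k * real (N choose k) / real N ^ k) \<longlonglongrightarrow> 1"
    using Lim_transform_eventually by fastforce
  then have "(\<lambda>N. fact k * real (N choose k) / real N ^ k * (1 / (fact k * fact (Suc k))))
      \<longlonglongrightarrow> 1 * (1 / (fact k * fact (Suc k)))"
    by (intro tendsto_mult tendsto_const)
  then show ?thesis by (simp del: fact_Suc)
qed

lemma catalan_sum_nonzero:
  fixes f :: "complex poly"
  assumes "t < 0" and f: "\<And>x. Re x > t \<Longrightarrow> poly f x \<noteq> 0"
  shows "(\<Sum>k\<le>degree f. fact (2 * k) / (fact k * fact (Suc k)) * coeff f (2 * k)) \<noteq> 0"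
    (is "?S \<noteq> 0")
proof
  assume S: "?S = 0"
  define a where "a = (\<lambda>N k. real (N choose k) / (real N ^ k * fact (Suc k)))"
  have "poly ((pderiv ^^ m) f) 0 = fact m * coeff f m" for m
    by (simp only: poly_0_coeff_0 coeff_higher_pderiv) (simp add: pochhammer_fact)
  then have ev: "poly (even_diff_op b f) 0
      = (\<Sum>k\<le>degree f. of_real (b k) * (fact (2 * k) * coeff f (2 * k)))" for b
    by (simp add: even_diff_op_def poly_sum)
  have "(\<lambda>N. poly (even_diff_op (a N) f) 0) \<longlonglongrightarrow>
      (\<Sum>k\<le>degree f. of_real (1 / (fact k * fact (Suc k))) * (fact (2 * k) * coeff f (2 * k)))"
    unfolding ev a_def by (intro tendsto_intros laguerre_coeff_tendsto)
  also have "(\<Sum>k\<le>degree f. of_real (1 / (fact k * fact (Suc k))) *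
      (fact (2 * k) * coeff f (2 * k))) = ?S"
    by (intro sum.cong) (simp_all del: fact_Suc)
  finally have lim: "(\<lambda>N. norm (poly (even_diff_op (a N) f) 0)) \<longlonglongrightarrow> 0"
    unfolding S by (rule tendsto_norm_zero)
  \<comment> \<open>The bound is positive and independent of \<open>N\<close>, because the operators
    keep degree, leading coefficient and zero-free half plane. So it survives the limit.\<close>
  have "norm (poly (even_diff_op (a N) f) 0) \<ge> norm (lead_coeff f) * (-t) ^ degree f" for N
  proof -
    obtain A where A: "\<forall>s\<in>#A. s \<ge> 0" "coeff (\<Prod>s\<in>#A. [:1, s:]) = a N"
      using laguerre_real_rooted[of N] unfolding a_def by blast
    show ?thesis
      using even_diff_op_stable[of A t f] norm_poly_0_ge[of t "even_diff_op (a N) f"] A assms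
      by auto
  qed
  then have "norm (lead_coeff f) * (-t) ^ degree f \<le> 0"
    using lim by (intro tendsto_lowerbound[OF lim]) auto
  moreover have "f \<noteq> 0" using f[of 0] assms(1) by auto
  then have "norm (lead_coeff f) * (-t) ^ degree f > 0" using assms(1) by simp
  ultimately show False by simp
qed

subsection \<open>Catalan moments\<close>

lemma coeff_one_plus_square_power:
  "coeff ((1 + monom 1 2 :: 'a :: comm_ring_1 poly) ^ m) j
     = (if even j then of_nat (m choose (j div 2)) else 0)"
proof (induction m arbitrary: j)
  case 0
  then show ?case by (cases "j = 0") (auto simp: binomial_eq_0 elim!: evenE)
next
  case (Suc m)
  have step: "coeff ((1 + monom 1 2 :: 'a poly) ^ Suc m) j = coeff ((1 + monom 1 2) ^ m) j
      + (if j < 2 then 0 else coeff ((1 + monom 1 2) ^ m) (j - 2))"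
    by (simp add: distrib_right coeff_monom_mult)
  show ?case
  proof (cases "j < 2")
    case True
    then have "j = 0 \<or> j = 1" by auto
    with step Suc show ?thesis by auto
  next
    case False
    then obtain i where "j = Suc (Suc i)"
      by (metis Suc_1 Suc_lessD add_2_eq_Suc' le_Suc_ex not_less add.commute)
    with step Suc show ?thesis by simp
  qed
qed

text \<open>For \<open>m = 2 * k\<close> with \<open>k > 0\<close> the coefficient is
  \<open>(2k choose k) - (2k choose (k - 1))\<close>, the Catalan number.\<close>

lemma coeff_catalan:
  "coeff ((1 - monom 1 2) * (1 + monom 1 2 :: 'a :: field_char_0 poly) ^ m) m
     = (if even m then fact m / (fact (m div 2) * fact (Suc (m div 2))) else 0)"
proof -
  have eq: "coeff ((1 - monom 1 2) * (1 + monom 1 2 :: 'a poly) ^ m) m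
      = coeff ((1 + monom 1 2) ^ m) m
        - (if m < 2 then 0 else coeff ((1 + monom 1 2) ^ m) (m - 2))"
    by (simp add: left_diff_distrib coeff_monom_mult)
  show ?thesis
  proof (cases "even m")
    case True
    then obtain k where k: "m = 2 * k" by (elim evenE)
    show ?thesis
    proof (cases k)
      case (Suc j)
      have "of_nat (2 * k choose k) = (fact (2 * k) / (fact k * fact k) :: 'a)"
        by (subst binomial_fact) (simp_all add: mult_2)
      moreover have "2 * k - j = Suc k" using Suc by simp
      then have "of_nat (2 * k choose j) = (fact (2 * k) / (fact j * fact (Suc k)) :: 'a)"
        using Suc by (subst binomial_fact) simp_all
      moreover have "fact (2 * k) / (fact k * fact k) - fact (2 * k) / (fact j * fact (Suc k))
          = (fact (2 * k) / (fact k * fact (Suc k)) :: 'a)"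
      proof -
        have "(fact k :: 'a) = of_nat k * fact j" "(of_nat k :: 'a) \<noteq> 0"
          "(fact (Suc k) :: 'a) = (of_nat k + 1) * fact k" "(of_nat k + 1 :: 'a) \<noteq> 0"
          using Suc of_nat_neq_0[of k, where 'a = 'a] of_nat_neq_0[of j, where 'a = 'a]
          by (simp_all add: add.commute)
        \<comment> \<open>The same identity with \<open>F = (2k)!\<close>, \<open>J = j!\<close> and
          \<open>a = k\<close>, where \<open>k! = a * J\<close>.\<close>
        moreover have "F / (a * J * (a * J)) - F / (J * ((a + 1) * (a * J)))
            = F / (a * J * ((a + 1) * (a * J)))"
          if "J \<noteq> 0" "a \<noteq> 0" "a + 1 \<noteq> 0" for F J a :: 'a
          using that by (simp add: divide_simps) (simp add: algebra_simps)
        ultimately show ?thesis by (simp only: fact_nonzero not_False_eq_True)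
      qed
      moreover have "(m - 2) div 2 = j" using k Suc by simp
      ultimately show ?thesis unfolding eq coeff_one_plus_square_power using k Suc by simp
    qed (simp add: eq k)
  qed (simp add: eq coeff_one_plus_square_power)
qed

text \<open>
  For \<open>z\<close> on the unit circle the sum on the left is the integral of \<open>S(z) S(1/z) (1 - z\<^sup>2)\<close>, so the
  right-hand side is the integral of \<open>f\<close> against the semicircle distribution, whose even moments are
  the Catalan numbers.
\<close>

lemma log_concave_sum_eq_catalan_sum:
  fixes S f :: "complex poly"
  assumes deg: "degree f \<le> degree S"
    and eq: "\<And>z. z \<noteq> 0 \<Longrightarrow> poly S z * poly S (1 / z) = poly f (z + 1 / z)"
  shows "(\<Sum>k\<le>degree S. (coeff S k)\<^sup>2 - (if k = 0 then 0 else coeff S (k - 1)) * coeff S (k + 1))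
    = (\<Sum>k\<le>degree f. fact (2 * k) / (fact k * fact (Suc k)) * coeff f (2 * k))"
proof -
  define n where "n = degree S"
  \<comment> \<open>\<open>Q(z) = z^n S(z) S(1/z)\<close>, so constant terms of Laurent polynomials
    become coefficients at \<open>n\<close>.\<close>
  define Q where "Q = S * reflect_poly S"
  have Q: "Q = (\<Sum>m\<le>degree f. smult (coeff f m) (monom 1 (n - m) * (1 + monom 1 2) ^ m))"
    (is "_ = ?R")
  proof -
    \<comment> \<open>The extra factor \<open>z\<close> makes the identity trivial at
      \<open>0\<close>, where \<open>1 / z\<close> is of no use.\<close>
    have "poly (monom 1 1 * Q) z = poly (monom 1 1 * ?R) z" for z
    proof (cases "z = 0")
      case False
      have "poly Q z = z ^ n * (poly S z * poly S (1 / z))"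
        using False by (simp add: Q_def n_def poly_reflect_poly_nz inverse_eq_divide mult_ac)
      also have "\<dots> = (\<Sum>m\<le>degree f. coeff f m * (z ^ n * (z + 1 / z) ^ m))"
        using False by (simp add: eq poly_altdef[of f] sum_distrib_left mult_ac)
      also have "\<dots> = (\<Sum>m\<le>degree f. coeff f m * (z ^ (n - m) * (1 + z ^ 2) ^ m))"
      proof (intro sum.cong refl arg_cong[where f = "(*) _"])
        fix m assume "m \<in> {..degree f}"
        then have "z ^ n = z ^ (n - m) * z ^ m"
          using deg by (simp add: n_def flip: power_add)
        moreover have "z ^ m * (z + 1 / z) ^ m = (1 + z ^ 2) ^ m"
          using False by (simp add: power2_eq_square field_simps flip: power_mult_distrib)
        ultimately show "z ^ n * (z + 1 / z) ^ m = z ^ (n - m) * (1 + z ^ 2) ^ m"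
          by (simp add: mult.assoc)
      qed
      also have "\<dots> = poly ?R z" by (simp add: poly_sum poly_monom)
      finally show ?thesis by simp
    qed (simp add: poly_monom)
    then have "poly (monom 1 1 * Q) = poly (monom 1 1 * ?R)" by (rule ext)
    then have "monom 1 1 * Q = monom 1 1 * ?R" by (simp only: poly_eq_poly_eq_iff)
    then show ?thesis by (metis (no_types, lifting) mult_cancel_left monom_eq_0_iff zero_neq_one)
  qed
  have refl_coeff: "coeff (reflect_poly S) (n - i) = coeff S i" if "i \<le> n" for i
    using that by (simp add: coeff_reflect_poly n_def)
  have "coeff ((1 - monom 1 2) * Q) n
      = coeff (S * reflect_poly S) n - coeff (monom 1 2 * S * reflect_poly S) n"
    by (simp add: Q_def algebra_simps)
  also have "coeff (S * reflect_poly S) n = (\<Sum>i\<le>n. (coeff S i)\<^sup>2)"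
    unfolding coeff_mult by (intro sum.cong) (auto simp: refl_coeff power2_eq_square)
  also have "coeff (monom 1 2 * S * reflect_poly S) n
      = (\<Sum>i\<le>n. (if i < 2 then 0 else coeff S (i - 2)) * coeff S i)"
    unfolding coeff_mult[of "monom 1 2 * S"]
    by (intro sum.cong) (auto simp: refl_coeff coeff_monom_mult)
  \<comment> \<open>The added term is zero; it prepares the shift \<open>i = k + 1\<close>.\<close>
  also have "\<dots> = (\<Sum>i\<le>Suc n. (if i < 2 then 0 else coeff S (i - 2)) * coeff S i)"
    by (simp add: n_def coeff_eq_0)
  also have "\<dots> = (\<Sum>k\<le>n. (if k = 0 then 0 else coeff S (k - 1)) * coeff S (k + 1))"
    by (subst sum.atMost_Suc_shift) (auto intro!: sum.cong)
  finally have lhs: "coeff ((1 - monom 1 2) * Q) n = (\<Sum>k\<le>n. (coeff S k)\<^sup>2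
      - (if k = 0 then 0 else coeff S (k - 1)) * coeff S (k + 1))"
    by (simp add: sum_subtractf)
  define h where "h m =
    (if even m then fact m / (fact (m div 2) * fact (Suc (m div 2))) else 0) * coeff f m" for m
  have "coeff ((1 - monom 1 2) * Q) n
      = (\<Sum>m\<le>degree f. coeff f m * coeff (monom 1 (n - m) * ((1 - monom 1 2) * (1 + monom 1 2) ^ m)) n)"
    by (simp add: Q sum_distrib_left coeff_sum mult.left_commute del: mult_smult_left)
  also have "\<dots> = (\<Sum>m\<le>degree f. h m)"
  proof (intro sum.cong refl)
    fix m assume "m \<in> {..degree f}"
    then have "m \<le> n" using deg by (simp add: n_def)
    then have "n - (n - m) = m" "\<not> n < n - m" by auto
    then show "coeff f m * coeff (monom 1 (n - m) * ((1 - monom 1 2) * (1 + monom 1 2) ^ m)) n = h m"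
      by (simp add: coeff_monom_mult coeff_catalan h_def del: fact_Suc)
  qed
  \<comment> \<open>Odd \<open>m\<close> contribute nothing, and the new indices above
    \<open>degree f\<close> carry zero coefficients.\<close>
  also have "\<dots> = (\<Sum>m\<in>(*) 2 ` {..degree f}. h m)"
    by (rule sum.mono_neutral_cong)
      (auto simp: h_def coeff_eq_0 image_iff elim!: evenE)
  also have "\<dots> = (\<Sum>k\<le>degree f. fact (2 * k) / (fact k * fact (Suc k)) * coeff f (2 * k))"
    by (subst sum.reindex) (auto simp: h_def inj_on_def simp del: fact_Suc)
  finally show ?thesis using lhs by (simp add: n_def)
qed

subsection \<open>Iterating the log-concavity operator\<close>

lemma roots_left_imp_half_plane:
  fixes f :: "complex poly"
  assumes "f \<noteq> 0" "\<And>x. poly f x = 0 \<Longrightarrow> Re x < 0"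
  obtains t where "t < 0" "\<And>x. Re x > t \<Longrightarrow> poly f x \<noteq> 0"
proof -
  \<comment> \<open>The element \<open>-1\<close> keeps the set nonempty when \<open>f\<close> has
    no zeros.\<close>
  define T where "T = insert (-1) (Re ` {x. poly f x = 0})"
  have "finite T" "T \<noteq> {}" using poly_roots_finite[OF assms(1)] by (auto simp: T_def)
  then have "Max T \<in> T" by (rule Max_in)
  then have "Max T < 0" using assms(2) by (auto simp: T_def)
  moreover have "poly f x \<noteq> 0" if "Re x > Max T" for x
    using Max_ge[OF \<open>finite T\<close>, of "Re x"] that by (auto simp: T_def)
  ultimately show thesis by (rule that)
qed

text \<open>The class preserved by the iteration. \<open>A\<close> lists the negated zeros with
  multiplicity; \<open>c > 0\<close> makes the coefficients nonnegative.\<close>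

definition nonpos_rooted :: "real poly \<Rightarrow> bool" where
  "nonpos_rooted p \<longleftrightarrow>
     (\<exists>c A. c > 0 \<and> (\<forall>r\<in>#A. r \<ge> 0) \<and> p = smult c (\<Prod>r\<in>#A. [:r, 1:]))"

lemma nonpos_rooted_coeff_nonneg:
  assumes "nonpos_rooted p"
  shows "coeff p k \<ge> 0"
proof -
  obtain c A where cA: "c > 0" "\<forall>r\<in>#A. r \<ge> 0" "p = smult c (\<Prod>r\<in>#A. [:r, 1:])"
    using assms unfolding nonpos_rooted_def by blast
  have "coeff (\<Prod>r\<in>#A. [:r, 1:]) k \<ge> 0" using cA(2)
    by (induction A arbitrary: k) (auto simp: coeff_pCons split: nat.splits)
  then show ?thesis using cA by simp
qed

lemma log_concave_poly_nonzero:
  assumes p: "nonpos_rooted p" and w: "w \<notin> \<real>\<^sub>\<le>\<^sub>0"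
  shows "(\<Sum>k\<le>degree p. of_real (log_concave_op (coeff p) k) * w ^ k) \<noteq> (0 :: complex)"
proof -
  obtain c A where cA: "c > 0" "\<forall>r\<in>#A. r \<ge> 0" "p = smult c (\<Prod>r\<in>#A. [:r, 1:])"
    using p unfolding nonpos_rooted_def by blast
  \<comment> \<open>The principal root has \<open>Re y \<ge> 0\<close>, with equality only for
    \<open>w\<close> on the excluded ray.\<close>
  define y where "y = csqrt w"
  have w_eq: "w = y\<^sup>2" by (simp add: y_def)
  have "Re y \<noteq> 0"
  proof
    assume "Re y = 0"
    then have "w = of_real (- (Im y)\<^sup>2)" unfolding w_eq by (simp add: complex_eq_iff power2_eq_square)
    moreover have "- (Im y)\<^sup>2 \<le> 0" by simp
    ultimately show False using w by (metis nonpos_Reals_of_real_iff)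
  qed
  moreover have "Re y \<ge> 0" unfolding y_def by (rule Re_csqrt)
  ultimately have y: "Re y > 0" by simp
  then have y0: "y \<noteq> 0" by auto
  define S where "S = map_poly complex_of_real p \<circ>\<^sub>p [:0, y:]"
  define f where "f = smult (of_real (c\<^sup>2)) (\<Prod>r\<in>#A. [: (of_real r)\<^sup>2 + y\<^sup>2, of_real r * y:])"
  have coeff_S: "coeff S k = of_real (coeff p k) * y ^ k" for k
    by (simp add: S_def coeff_pcompose_linear coeff_map_poly)
  have deg_S: "degree S = degree p" using y0 by (simp add: S_def degree_map_poly degree_pcompose)
  have "degree (\<Prod>r\<in>#B. [:r, 1:]) = size B" for B :: "real multiset"
  proof (induction B)
    case (add r B)
    have "(\<Prod>r\<in>#B. [:r, 1:]) \<noteq> 0" by (auto simp: prod_mset_zero_iff)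
    then show ?case using add unfolding image_mset_add_mset prod_mset.add_mset
      by (subst degree_mult_eq) auto
  qed simp
  then have "degree p = size A" using cA(1,3) by simp
  \<comment> \<open>Only an inequality: each \<open>r = 0\<close> gives a constant factor.\<close>
  moreover have "degree f \<le> size A"
    unfolding f_def
  proof (rule order.trans[OF degree_smult_le], induction A)
    case (add r A)
    then show ?case
      by (auto intro!: order.trans[OF degree_mult_le] simp del: mult_pCons_left)
  qed simp
  ultimately have deg: "degree f \<le> degree S" by (simp add: deg_S)
  have "poly (map_poly complex_of_real (\<Prod>r\<in>#B. [:r, 1:])) x = (\<Prod>r\<in>#B. of_real r + x)"
    for B x
    by (induction B) (simp_all add: map_poly_of_real_mult map_poly_of_real_pCons del: mult_pCons_left)
  then have poly_p: "poly (map_poly complex_of_real p) x = of_real c * (\<Prod>r\<in>#A. of_real r + x)" for x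
    by (simp add: cA(3) map_poly_smult)
  have eq: "poly S z * poly S (1 / z) = poly f (z + 1 / z)" if "z \<noteq> 0" for z
  proof -
    have "poly S z * poly S (1 / z)
        = of_real (c\<^sup>2) * (\<Prod>r\<in>#A. (of_real r + y * z) * (of_real r + y * (1 / z)))"
      by (simp add: S_def poly_pcompose poly_p power2_eq_square prod_mset.distrib mult_ac)
    also have "(\<lambda>r. (of_real r + y * z) * (of_real r + y * (1 / z)))
        = (\<lambda>r. (of_real r)\<^sup>2 + y\<^sup>2 + (z + 1 / z) * (of_real r * y))"
      using that by (simp add: fun_eq_iff field_simps power2_eq_square)
    finally show ?thesis by (simp add: f_def poly_prod_mset image_mset.compositionality o_def)
  qed
  have "of_real (log_concave_op (coeff p) k) * w ^ k
      = (coeff S k)\<^sup>2 - (if k = 0 then 0 else coeff S (k - 1)) * coeff S (k + 1)" for k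
    by (cases k) (simp_all add: coeff_S log_concave_op_def w_eq power2_eq_square
      power_mult_distrib algebra_simps)
  then have "(\<Sum>k\<le>degree p. of_real (log_concave_op (coeff p) k) * w ^ k)
      = (\<Sum>k\<le>degree f. fact (2 * k) / (fact k * fact (Suc k)) * coeff f (2 * k))"
    using log_concave_sum_eq_catalan_sum[OF deg eq] by (simp only: deg_S simp_thms)
  also have "\<dots> \<noteq> 0"
  proof -
    \<comment> \<open>For \<open>r = 0\<close> the factor is the nonzero constant
      \<open>y^2\<close>; otherwise its only zero is \<open>- (r / y + y / r)\<close>, with negative
      real part.\<close>
    have factor: "(of_real r)\<^sup>2 + y\<^sup>2 + x * (of_real r * y) \<noteq> 0" if "r \<ge> 0" "Re x \<ge> 0" for r x
    proof
      assume eq: "(of_real r)\<^sup>2 + y\<^sup>2 + x * (of_real r * y) = 0"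
      have "r > 0" using eq y0 that(1) by (cases "r = 0") auto
      have "x = - (of_real r * inverse y + y * of_real (1 / r))"
        using eq \<open>r > 0\<close> y0 by (simp add: field_simps power2_eq_square add_eq_0_iff)
      then have "Re x = - (r * Re (inverse y) + Re y * (1 / r))"
        by (simp only: uminus_complex.sel plus_complex.sel times_complex.sel) simp
      moreover have "r * Re (inverse y) > 0"
        using \<open>r > 0\<close> Re_inverse_pos[OF y] by (rule mult_pos_pos)
      moreover have "Re y * (1 / r) > 0" using \<open>r > 0\<close> y by simp
      ultimately show False using that(2) by linarith
    qed
    have nz: "poly f x \<noteq> 0" if "Re x \<ge> 0" for x
      using that factor cA(1,2) by (auto simp: f_def poly_prod_mset)
    then have "f \<noteq> 0" by (metis poly_0 zero_complex.sel(1) order_refl)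
    moreover have "Re x < 0" if "poly f x = 0" for x using nz that by force
    ultimately obtain t where "t < 0" "\<And>x. Re x > t \<Longrightarrow> poly f x \<noteq> 0"
      using roots_left_imp_half_plane[of f] by blast
    then show ?thesis by (rule catalan_sum_nonzero)
  qed
  finally show ?thesis .
qed

lemma nonpos_rooted_log_concave_op:
  assumes p: "nonpos_rooted p"
  shows "\<exists>q. nonpos_rooted q \<and> coeff q = log_concave_op (coeff p)"
proof -
  define n where "n = degree p"
  define q where "q = (\<Sum>k\<le>n. monom (log_concave_op (coeff p) k) k)"
  have coeff_q: "coeff q k = log_concave_op (coeff p) k" for k
    by (auto simp: q_def coeff_sum n_def log_concave_op_def coeff_eq_0)
  have "p \<noteq> 0" using p by (auto simp: nonpos_rooted_def)
  \<comment> \<open>The top entry is the square of the leading coefficient of \<open>p\<close>; it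
    serves as the positive constant \<open>c\<close> for \<open>q\<close>.\<close>
  then have qn: "coeff q n > 0"
    by (simp add: coeff_q log_concave_op_def n_def coeff_eq_0)
  then have "q \<noteq> 0" by auto
  have "degree q = n"
  proof (rule antisym)
    show "degree q \<le> n" unfolding q_def
      by (intro degree_sum_le) (auto intro: order.trans[OF degree_monom_le])
    show "n \<le> degree q" using qn by (intro le_degree) simp
  qed
  have "poly (map_poly complex_of_real q) w
      = (\<Sum>k\<le>n. of_real (log_concave_op (coeff p) k) * w ^ k)" for w
    by (simp add: poly_altdef degree_map_poly \<open>degree q = n\<close> coeff_map_poly coeff_q)
  then have "poly (map_poly complex_of_real q) w \<noteq> 0" if "w \<notin> \<real>\<^sub>\<le>\<^sub>0" for w
    using log_concave_poly_nonzero[OF p that] by (simp add: n_def)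
  from nonpos_roots_imp_factorization[OF \<open>q \<noteq> 0\<close> this]
  have "nonpos_rooted q" using qn unfolding nonpos_rooted_def \<open>degree q = n\<close> by blast
  then show ?thesis using coeff_q by blast
qed

lemma nonpos_rooted_imp_infinitely_log_concave:
  assumes "nonpos_rooted p"
  shows "infinitely_log_concave (coeff p)"
proof -
  have "\<exists>q. nonpos_rooted q \<and> coeff q = (log_concave_op ^^ i) (coeff p)" for i
  proof (induction i)
    case (Suc i)
    then show ?case using nonpos_rooted_log_concave_op by fastforce
  qed (use assms in auto)
  then show ?thesis unfolding infinitely_log_concave_def
    by (metis nonpos_rooted_coeff_nonneg)
qed

theorem theorem2p2:
  fixes n :: nat
  assumes "n \<le> 1450"
  shows "infinitely_log_concave (\<lambda>k. real (n choose k))"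
proof -
  have "coeff ([:1, 1:] ^ n) k = real (n choose k)" for k
    using coeff_linear_poly_power[of k n "1 :: real" 1]
    by (cases "k \<le> n") (simp_all add: coeff_eq_0 degree_linear_power binomial_eq_0)
  then have "(\<lambda>k. real (n choose k)) = coeff ([:1, 1:] ^ n)" by auto
  moreover have "nonpos_rooted ([:1, 1:] ^ n)"
    unfolding nonpos_rooted_def
    by (intro exI[of _ 1] exI[of _ "replicate_mset n 1"]) auto
  ultimately show ?thesis by (simp add: nonpos_rooted_imp_infinitely_log_concave)
qed

end
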